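(* Let $m,n\ge 2$ be integers. The localization homomorphism $\pi: G_{m,n}^{+}\to G_{m,n}$ (the natural monoid homomorphism sending each generator to the generator of the same name) is injective.
   Context: For letters $x_1,\dots,x_k$, the symbol $[x_1,x_2,\dots,x_k]$ denotes the cyclic relations $x_1x_2\cdots x_k=x_2\cdots x_kx_1=x_3\cdots x_kx_1x_2=\cdots=x_kx_1\cdots x_{k-1}$ (all cyclic rotations of the word are equal); in particular $[x,y]$ denotes $xy=yx$. $G_{m,n}$ is the group, and $G_{m,n}^{+}$ the monoid, presented by the generators $s,t_1,\dots,t_m,u_1,\dots,u_n$ and the relations $[s,t_1,\dots,t_m]$, $[s,u_1,\dots,u_n]$, and $[t_i,u_j]$ for all $1\le i\le m$, $1\le j\le n$. *)

theory Defs
  imports "HOL-Algebra.Group"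
begin

inductive_set word_cong :: "'a set \<Rightarrow> ('a list \<times> 'a list) set \<Rightarrow> ('a list \<times> 'a list) set"
  for A :: "'a set" and R :: "('a list \<times> 'a list) set" where
  rel: "\<lbrakk>(u, v) \<in> R; u \<in> lists A; v \<in> lists A\<rbrakk> \<Longrightarrow> (u, v) \<in> word_cong A R"
| refl: "u \<in> lists A \<Longrightarrow> (u, u) \<in> word_cong A R"
| sym: "(u, v) \<in> word_cong A R \<Longrightarrow> (v, u) \<in> word_cong A R"
| trans: "\<lbrakk>(u, v) \<in> word_cong A R; (v, w) \<in> word_cong A R\<rbrakk> \<Longrightarrow> (u, w) \<in> word_cong A R"
| append: "\<lbrakk>(u, v) \<in> word_cong A R; (u', v') \<in> word_cong A R\<rbrakk>
    \<Longrightarrow> (u @ u', v @ v') \<in> word_cong A R"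

definition presented_monoid :: "'a set \<Rightarrow> ('a list \<times> 'a list) set \<Rightarrow> 'a list set monoid" where
  "presented_monoid A R =
    \<lparr>carrier = lists A // word_cong A R,
     mult = (\<lambda>X Y. \<Union>x\<in>X. \<Union>y\<in>Y. word_cong A R `` {x @ y}),
     one = word_cong A R `` {[]}\<rparr>"

datatype 'a letter = Pos 'a | Neg 'a

text \<open>The group with generators \<open>A\<close> and relations \<open>R\<close> between positive words, presented as a
  monoid on the letters \<open>Pos a\<close> (for \<open>a\<close>) and \<open>Neg a\<close> (for the inverse of \<open>a\<close>).\<close>

definition group_letters :: "'a set \<Rightarrow> 'a letter set" where
  "group_letters A = Pos ` A \<union> Neg ` A"

definition group_rels :: "'a set \<Rightarrow> ('a list \<times> 'a list) set \<Rightarrow> ('a letter list \<times> 'a letter list) set" where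
  "group_rels A R =
    {(map Pos u, map Pos v) | u v. (u, v) \<in> R} \<union>
    {([Pos a, Neg a], []) | a. a \<in> A} \<union> {([Neg a, Pos a], []) | a. a \<in> A}"

definition presented_group :: "'a set \<Rightarrow> ('a list \<times> 'a list) set \<Rightarrow> 'a letter list set monoid" where
  "presented_group A R = presented_monoid (group_letters A) (group_rels A R)"

text \<open>The value on the class of a word does not depend on the word; \<open>localization_class\<close> below
  gives it as a single class.\<close>

definition localization :: "'a set \<Rightarrow> ('a list \<times> 'a list) set \<Rightarrow> 'a list set \<Rightarrow> 'a letter list set" where
  "localization A R X =
    (\<Union>w\<in>X. word_cong (group_letters A) (group_rels A R) `` {map Pos w})"

datatype gen = gen_s | gen_t nat | gen_u nat

definition cyclic_rels :: "'a list \<Rightarrow> ('a list \<times> 'a list) set" where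
  "cyclic_rels xs = {(rotate i xs, rotate j xs) | i j. True}"

definition gens :: "nat \<Rightarrow> nat \<Rightarrow> gen set" where
  "gens m n = {gen_s} \<union> gen_t ` {1..m} \<union> gen_u ` {1..n}"

definition rels :: "nat \<Rightarrow> nat \<Rightarrow> (gen list \<times> gen list) set" where
  "rels m n =
    cyclic_rels (gen_s # map gen_t [1..<Suc m]) \<union>
    cyclic_rels (gen_s # map gen_u [1..<Suc n]) \<union>
    (\<Union>i\<in>{1..m}. \<Union>j\<in>{1..n}. cyclic_rels [gen_t i, gen_u j])"

definition G_monoid :: "nat \<Rightarrow> nat \<Rightarrow> gen list set monoid" where
  "G_monoid m n = presented_monoid (gens m n) (rels m n)"

definition G_group :: "nat \<Rightarrow> nat \<Rightarrow> gen letter list set monoid" where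
  "G_group m n = presented_group (gens m n) (rels m n)"

definition localization_hom :: "nat \<Rightarrow> nat \<Rightarrow> gen list set \<Rightarrow> gen letter list set" where
  "localization_hom m n = localization (gens m n) (rels m n)"


subsection \<open>Well-definedness, and the characterization of the localization map\<close>

text \<open>\<open>word_cong\<close> ignores relations between words outside \<open>lists A\<close>; there are none here.\<close>

lemma rels_lists: "rels m n \<subseteq> lists (gens m n) \<times> lists (gens m n)"
  by (auto simp: rels_def cyclic_rels_def gens_def in_lists_conv_set)

lemma word_cong_lists: "(u, v) \<in> word_cong A R \<Longrightarrow> u \<in> lists A \<and> v \<in> lists A"
  by (induction rule: word_cong.induct) auto

lemma equiv_word_cong: "equiv (lists A) (word_cong A R)"
proof (rule equivI)
  show "word_cong A R \<subseteq> lists A \<times> lists A"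
    using word_cong_lists by fast
  show "refl_on (lists A) (word_cong A R)"
    by (auto simp: refl_on_def intro: word_cong.refl)
  show "sym (word_cong A R)"
    by (rule symI) (rule word_cong.sym)
  show "trans (word_cong A R)"
    by (rule transI) (rule word_cong.trans)
qed

lemma word_cong_class_eq_iff:
  assumes "u \<in> lists A" "v \<in> lists A"
  shows "word_cong A R `` {u} = word_cong A R `` {v} \<longleftrightarrow> (u, v) \<in> word_cong A R"
  using eq_equiv_class_iff[OF equiv_word_cong] assms by metis

lemma presented_monoid_one: "\<one>\<^bsub>presented_monoid A R\<^esub> = word_cong A R `` {[]}"
  by (simp add: presented_monoid_def)

lemma presented_monoid_mult:
  assumes "u \<in> lists A" "v \<in> lists A"
  shows "word_cong A R `` {u} \<otimes>\<^bsub>presented_monoid A R\<^esub> word_cong A R `` {v} = word_cong A R `` {u @ v}"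
proof -
  have "congruent2 (word_cong A R) (word_cong A R) (\<lambda>x y. word_cong A R `` {x @ y})"
    unfolding congruent2_def
    by (auto intro!: equiv_class_eq[OF equiv_word_cong] word_cong.append)
  from UN_equiv_class2[OF equiv_word_cong equiv_word_cong this] assms show ?thesis
    by (simp add: presented_monoid_def)
qed

lemma presented_monoid_carrierE:
  assumes "X \<in> carrier (presented_monoid A R)"
  obtains w where "w \<in> lists A" "X = word_cong A R `` {w}"
  using assms by (auto simp: presented_monoid_def elim!: quotientE)

lemma presented_monoid_carrierI:
  "w \<in> lists A \<Longrightarrow> word_cong A R `` {w} \<in> carrier (presented_monoid A R)"
  by (auto simp: presented_monoid_def intro: quotientI)

lemma monoid_presented_monoid: "monoid (presented_monoid A R)"
proof (rule monoidI)
  fix X Y Z assume XYZ: "X \<in> carrier (presented_monoid A R)" "Y \<in> carrier (presented_monoid A R)"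
    "Z \<in> carrier (presented_monoid A R)"
  show "X \<otimes>\<^bsub>presented_monoid A R\<^esub> Y \<in> carrier (presented_monoid A R)"
    using XYZ(1,2) by (elim presented_monoid_carrierE)
      (auto simp: presented_monoid_mult intro!: presented_monoid_carrierI)
  show "X \<otimes>\<^bsub>presented_monoid A R\<^esub> Y \<otimes>\<^bsub>presented_monoid A R\<^esub> Z =
    X \<otimes>\<^bsub>presented_monoid A R\<^esub> (Y \<otimes>\<^bsub>presented_monoid A R\<^esub> Z)"
    using XYZ by (elim presented_monoid_carrierE) (simp add: presented_monoid_mult)
next
  show "\<one>\<^bsub>presented_monoid A R\<^esub> \<in> carrier (presented_monoid A R)"
    by (simp add: presented_monoid_one presented_monoid_carrierI)
next
  fix X assume X: "X \<in> carrier (presented_monoid A R)"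
  show "\<one>\<^bsub>presented_monoid A R\<^esub> \<otimes>\<^bsub>presented_monoid A R\<^esub> X = X"
    "X \<otimes>\<^bsub>presented_monoid A R\<^esub> \<one>\<^bsub>presented_monoid A R\<^esub> = X"
    using X by (elim presented_monoid_carrierE; simp add: presented_monoid_one presented_monoid_mult)+
qed

fun flip :: "'a letter \<Rightarrow> 'a letter" where
  "flip (Pos a) = Neg a"
| "flip (Neg a) = Pos a"

lemma flip_lists:
  assumes "w \<in> lists (group_letters A)"
  shows "map flip (rev w) \<in> lists (group_letters A)"
proof -
  have "flip x \<in> group_letters A" if "x \<in> group_letters A" for x
    using that by (cases x) (auto simp: group_letters_def)
  with assms show ?thesis by (auto simp: in_lists_conv_set)
qed

lemma flip_cancel:
  assumes "w \<in> lists (group_letters A)"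
  shows "(map flip (rev w) @ w, []) \<in> word_cong (group_letters A) (group_rels A R)"
  using assms
proof (induction w)
  case Nil
  then show ?case by (simp add: word_cong.refl)
next
  case (Cons x w)
  let ?C = "word_cong (group_letters A) (group_rels A R)"
  have x: "([flip x, x], []) \<in> ?C"
    using Cons.hyps by (intro word_cong.rel) (auto simp: group_letters_def group_rels_def)
  have w: "w \<in> lists (group_letters A)" "map flip (rev w) \<in> lists (group_letters A)"
    using Cons.hyps flip_lists[of w A] by auto
  have "(map flip (rev w) @ ([flip x, x] @ w), map flip (rev w) @ ([] @ w)) \<in> ?C"
    using x w by (intro word_cong.append word_cong.refl)
  from word_cong.trans[OF this] Cons.IH show ?case
    by simp
qed

lemma group_presented_group: "group (presented_group A R)"
  unfolding presented_group_def
proof (rule monoid.group_l_invI[OF monoid_presented_monoid])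
  let ?M = "presented_monoid (group_letters A) (group_rels A R)"
  fix X assume "X \<in> carrier ?M"
  then obtain w where w: "w \<in> lists (group_letters A)"
    "X = word_cong (group_letters A) (group_rels A R) `` {w}"
    by (rule presented_monoid_carrierE)
  have f: "map flip (rev w) \<in> lists (group_letters A)"
    using w(1) by (rule flip_lists)
  then show "\<exists>Y\<in>carrier ?M. Y \<otimes>\<^bsub>?M\<^esub> X = \<one>\<^bsub>?M\<^esub>"
    using w flip_cancel[OF w(1)]
    by (intro bexI[OF _ presented_monoid_carrierI[OF f]])
      (simp add: presented_monoid_mult presented_monoid_one equiv_class_eq[OF equiv_word_cong])
qed

lemma map_Pos_cong:
  "(u, v) \<in> word_cong A R \<Longrightarrow>
    (map Pos u, map Pos v) \<in> word_cong (group_letters A) (group_rels A R)"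
proof (induction rule: word_cong.induct)
  case (rel u v)
  then show ?case
    by (intro word_cong.rel) (auto simp: group_letters_def group_rels_def)
next
  case (refl u)
  then show ?case by (intro word_cong.refl) (auto simp: group_letters_def)
qed (auto intro: word_cong.sym word_cong.trans word_cong.append)

lemma localization_class:
  assumes "w \<in> lists A"
  shows "localization A R (word_cong A R `` {w}) =
    word_cong (group_letters A) (group_rels A R) `` {map Pos w}"
  unfolding localization_def
  by (rule UN_equiv_class[OF equiv_word_cong _ assms])
    (auto simp: congruent_def intro!: equiv_class_eq[OF equiv_word_cong] map_Pos_cong)

lemma localization_mem_hom:
  "localization A R \<in> hom (presented_monoid A R) (presented_group A R)"
proof (rule homI)
  fix X Y assume XY: "X \<in> carrier (presented_monoid A R)" "Y \<in> carrier (presented_monoid A R)"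
  have pos: "map Pos w \<in> lists (group_letters A)" if "w \<in> lists A" for w
    using that by (auto simp: group_letters_def)
  show "localization A R X \<in> carrier (presented_group A R)"
    using XY(1) unfolding presented_group_def
    by (elim presented_monoid_carrierE)
      (simp only: localization_class presented_monoid_carrierI pos)
  from XY obtain u v where "u \<in> lists A" "X = word_cong A R `` {u}"
    "v \<in> lists A" "Y = word_cong A R `` {v}"
    by (elim presented_monoid_carrierE)
  moreover from this have "u @ v \<in> lists A" by simp
  ultimately show "localization A R (X \<otimes>\<^bsub>presented_monoid A R\<^esub> Y) =
    localization A R X \<otimes>\<^bsub>presented_group A R\<^esub> localization A R Y"
    unfolding presented_group_def
    by (simp only: presented_monoid_mult localization_class pos map_append)
qed

lemma localization_one:
  "localization A R \<one>\<^bsub>presented_monoid A R\<^esub> = \<one>\<^bsub>presented_group A R\<^esub>"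
  by (simp add: presented_group_def presented_monoid_one localization_class)

lemma localization_unique:
  assumes h: "h \<in> hom (presented_monoid A R) (presented_group A R)"
    and one: "h \<one>\<^bsub>presented_monoid A R\<^esub> = \<one>\<^bsub>presented_group A R\<^esub>"
    and gen: "\<And>a. a \<in> A \<Longrightarrow>
      h (word_cong A R `` {[a]}) = word_cong (group_letters A) (group_rels A R) `` {[Pos a]}"
    and X: "X \<in> carrier (presented_monoid A R)"
  shows "h X = localization A R X"
proof -
  have "h (word_cong A R `` {w}) = localization A R (word_cong A R `` {w})" if "w \<in> lists A" for w
    using that
  proof (induction w)
    case Nil
    then show ?case using one localization_one[of A R] by (simp add: presented_monoid_one)
  next
    case (Cons a w)
    have a: "[a] \<in> lists A" using Cons.hyps by simp
    have "word_cong A R `` {a # w} =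
      word_cong A R `` {[a]} \<otimes>\<^bsub>presented_monoid A R\<^esub> word_cong A R `` {w}"
      using presented_monoid_mult[OF a Cons.hyps(2), of R] by simp
    then show ?case
      using hom_mult[OF h] hom_mult[OF localization_mem_hom[of A R]]
        presented_monoid_carrierI[OF a, of R] presented_monoid_carrierI[OF Cons.hyps(2), of R]
        Cons gen[of a] localization_class[OF a, of R]
      by simp
  qed
  with X show ?thesis by (metis presented_monoid_carrierE)
qed

end

theory Submission
  imports Defs
begin

text \<open>The relations \<open>[t\<^sub>i, u\<^sub>j]\<close> separate the two families of letters: erasing the \<open>u\<^sub>j\<close> and erasing
  the \<open>t\<^sub>i\<close> identifies the monoid with the fibre product, over the number of occurrences of \<open>s\<close>, of
  the monoids presented by the single cyclic relations \<open>[s, t\<^sub>1, \<dots>, t\<^sub>m]\<close> and \<open>[s, u\<^sub>1, \<dots>, u\<^sub>n]\<close>.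
  A monoid with a single cyclic relation is left cancellative by a Garside-type argument, since any
  two distinct letters have the cyclic word as their least common right multiple. Hence the element
  \<open>s t\<^sub>1 \<dots> t\<^sub>m u\<^sub>1 \<dots> u\<^sub>n\<close> is cancellable; it is central and every generator divides it, so the group
  is obtained by inverting this one element.\<close>

section \<open>Closure properties of word congruences\<close>

lemma word_cong_append_left:
  "(x, y) \<in> word_cong A R \<Longrightarrow> p \<in> lists A \<Longrightarrow> (p @ x, p @ y) \<in> word_cong A R"
  by (intro word_cong.append word_cong.refl)

lemma word_cong_append_right:
  "(x, y) \<in> word_cong A R \<Longrightarrow> p \<in> lists A \<Longrightarrow> (x @ p, y @ p) \<in> word_cong A R"
  by (intro word_cong.append word_cong.refl)

lemma word_cong_Cons:
  "(x, y) \<in> word_cong A R \<Longrightarrow> a \<in> A \<Longrightarrow> (a # x, a # y) \<in> word_cong A R"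
  using word_cong_append_left[of x y A R "[a]"] by simp

lemma word_cong_mono:
  assumes "(x, y) \<in> word_cong A R" "A \<subseteq> B" "R \<subseteq> S"
  shows "(x, y) \<in> word_cong B S"
  using assms(1)
proof (induction rule: word_cong.induct)
  case (rel u v)
  then show ?case using assms(2,3) by (intro word_cong.rel) auto
next
  case (refl u)
  then show ?case using assms(2) by (intro word_cong.refl) auto
qed (auto intro: word_cong.sym word_cong.trans word_cong.append)

lemma word_cong_comm_append:
  assumes "(x @ a, a @ x) \<in> word_cong A R" "(x @ b, b @ x) \<in> word_cong A R"
  shows "(x @ a @ b, (a @ b) @ x) \<in> word_cong A R"
proof -
  have "x @ a \<in> lists A" "x @ b \<in> lists A"
    using word_cong_lists[OF assms(1)] word_cong_lists[OF assms(2)] by auto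
  then have "((x @ a) @ b, (a @ x) @ b) \<in> word_cong A R" "(a @ x @ b, a @ b @ x) \<in> word_cong A R"
    using word_cong_append_right[OF assms(1)] word_cong_append_left[OF assms(2)] by auto
  then show ?thesis by (auto intro: word_cong.trans)
qed

lemma word_cong_comm_lists:
  assumes "\<And>a. a \<in> set w \<Longrightarrow> (x @ [a], a # x) \<in> word_cong A R" "x \<in> lists A"
  shows "(x @ w, w @ x) \<in> word_cong A R"
  using assms(1)
proof (induction w)
  case Nil
  then show ?case using assms(2) by (simp add: word_cong.refl)
next
  case (Cons a w)
  then show ?case using word_cong_comm_append[of x "[a]" A R w] by simp
qed


subsection \<open>Inverting a central element\<close>

text \<open>Clears denominators: a group word stands for \<open>D\<close> to minus the number of its negative letters
  times the positive word in which each \<open>Neg a\<close> is replaced by \<open>d a\<close>, the quotient of \<open>D\<close> by \<open>a\<close>.\<close>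

definition clear :: "('a \<Rightarrow> 'a list) \<Rightarrow> 'a letter list \<Rightarrow> 'a list" where
  "clear d g = concat (map (case_letter (\<lambda>a. [a]) d) g)"

definition neg_count :: "'a letter list \<Rightarrow> nat" where
  "neg_count g = length (filter (case_letter (\<lambda>_. False) (\<lambda>_. True)) g)"

definition word_pow :: "'a list \<Rightarrow> nat \<Rightarrow> 'a list" where
  "word_pow D k = concat (replicate k D)"

lemma clear_append [simp]: "clear d (g @ h) = clear d g @ clear d h"
  by (simp add: clear_def)

lemma clear_map_Pos [simp]: "clear d (map Pos w) = w"
  by (induction w) (auto simp: clear_def)

lemma neg_count_append [simp]: "neg_count (g @ h) = neg_count g + neg_count h"
  by (simp add: neg_count_def)

lemma neg_count_map_Pos [simp]: "neg_count (map Pos w) = 0"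
  by (induction w) (auto simp: neg_count_def)

lemma word_pow_0 [simp]: "word_pow D 0 = []"
  by (simp add: word_pow_def)

lemma word_pow_add: "word_pow D (k + l) = word_pow D k @ word_pow D l"
  by (simp add: word_pow_def replicate_add)

lemma word_pow_in_lists: "D \<in> lists A \<Longrightarrow> word_pow D k \<in> lists A"
  by (induction k) (auto simp: word_pow_def)

text \<open>The two divisibility hypotheses make \<open>D\<close> central, so group words behave
  like fractions with denominator a power of \<open>D\<close>. Equality of fractions,
  cross-multiplied, is an invariant of the group congruence; on positive words no denominator is
  left and it becomes the monoid congruence.\<close>

lemma localization_inj_on:
  fixes A :: "'a set" and R D d
  defines "C \<equiv> word_cong A R"
  assumes right: "\<And>a. a \<in> A \<Longrightarrow> (a # d a, D) \<in> C"
    and left: "\<And>a. a \<in> A \<Longrightarrow> (d a @ [a], D) \<in> C"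
    and D: "D \<in> lists A"
    and cancel: "\<And>x y. (D @ x, D @ y) \<in> C \<Longrightarrow> (x, y) \<in> C"
  shows "inj_on (localization A R) (carrier (presented_monoid A R))"
proof -
  note cong = word_cong.trans[of _ _ A R, folded C_def]
  note sym = word_cong.sym[of _ _ A R, folded C_def]
  note apl = word_cong_append_left[of _ _ A R, folded C_def]
  note apr = word_cong_append_right[of _ _ A R, folded C_def]
  have d: "d a \<in> lists A" if "a \<in> A" for a
    using word_cong_lists[OF right[OF that, unfolded C_def]] by simp
  \<comment> \<open>For a single letter,
    \<open>D a = (a (d a)) a = a ((d a) a) = a D\<close>.\<close>
  have central: "(D @ w, w @ D) \<in> C" if "w \<in> lists A" for w
    unfolding C_def
  proof (rule word_cong_comm_lists[OF _ D])
    fix a assume "a \<in> set w"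
    then have a: "a \<in> A" using that by auto
    have "(D @ [a], (a # d a) @ [a]) \<in> C" using apr[OF sym[OF right[OF a]]] a by simp
    moreover have "([a] @ d a @ [a], [a] @ D) \<in> C"
      using apl[OF left[OF a], of "[a]"] a by simp
    ultimately show "(D @ [a], a # D) \<in> word_cong A R" using cong by (auto simp: C_def)
  qed
  have pow_lists: "word_pow D k \<in> lists A" for k
    using D by (rule word_pow_in_lists)
  have pow_central: "(word_pow D k @ w, w @ word_pow D k) \<in> C" if "w \<in> lists A" for k w
  proof (induction k)
    case 0
    then show ?case using that by (simp add: C_def word_cong.refl)
  next
    case (Suc k)
    have "(w @ word_pow D k @ D, (word_pow D k @ D) @ w) \<in> C"
      unfolding C_def
      by (rule word_cong_comm_append) (use sym[OF Suc] sym[OF central[OF that]] in \<open>simp_all add: C_def\<close>)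
    then show ?case using word_pow_add[of D k 1] sym by (simp add: word_pow_def)
  qed
  have pow_cancel: "(x, y) \<in> C" if "(word_pow D k @ x, word_pow D k @ y) \<in> C" for k x y
    using that
  proof (induction k)
    case (Suc k)
    then show ?case using cancel by (auto simp: word_pow_def)
  qed simp
  have clear_lists: "clear d g \<in> lists A" if "g \<in> lists (group_letters A)" for g
    using that d by (auto simp: clear_def group_letters_def in_lists_conv_set split: letter.splits)
  \<comment> \<open>Cross-multiplied equality of the fractions
    \<open>clear d g / D^(neg_count g)\<close> and
    \<open>clear d h / D^(neg_count h)\<close>.\<close>
  have main: "(word_pow D (neg_count h) @ clear d g, word_pow D (neg_count g) @ clear d h) \<in> C"
    if "(g, h) \<in> word_cong (group_letters A) (group_rels A R)" for g h
    using that
  proof (induction rule: word_cong.induct)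
    case (rel g h)
    then consider (pos) u v where "g = map Pos u" "h = map Pos v" "(u, v) \<in> R"
      | (pn) a where "a \<in> A" "g = [Pos a, Neg a]" "h = []"
      | (np) a where "a \<in> A" "g = [Neg a, Pos a]" "h = []"
      by (auto simp: group_rels_def)
    then show ?case
    proof cases
      case pos
      with rel have "u \<in> lists A" "v \<in> lists A"
        by (auto simp: group_letters_def in_lists_conv_set)
      with pos show ?thesis by (simp add: C_def word_cong.rel)
    next
      case pn
      then show ?thesis using right by (simp add: neg_count_def clear_def word_pow_def)
    next
      case np
      then show ?thesis using left by (simp add: neg_count_def clear_def word_pow_def)
    qed
  next
    case (refl g)
    then show ?case using pow_lists clear_lists by (simp add: C_def word_cong.refl)
  next
    case (sym g h)
    then show ?case using word_cong.sym by (auto simp: C_def)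
  next
    case (trans g h k)
    let ?p = "\<lambda>g. word_pow D (neg_count g)"
    have swap: "?p a @ ?p b = ?p b @ ?p a" for a b
      by (metis add.commute word_pow_add)
    \<comment> \<open>Each induction hypothesis is multiplied by the power of \<open>D\<close> that
      it lacks; the common factor \<open>?p h\<close> is then cancelled, which is where
      cancellability of \<open>D\<close> enters.\<close>
    have "(?p h @ ?p k @ clear d g, ?p k @ ?p g @ clear d h) \<in> C"
      using apl[OF trans.IH(1) pow_lists] swap by (metis append.assoc)
    moreover have "(?p k @ ?p g @ clear d h, ?p h @ ?p g @ clear d k) \<in> C"
      using apl[OF trans.IH(2) pow_lists] swap by (metis append.assoc)
    ultimately show ?case using cong pow_cancel by blast
  next
    case (append g h g' h')
    let ?p = "\<lambda>g. word_pow D (neg_count g)"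
    have gl: "clear d g \<in> lists A" "clear d h \<in> lists A"
      using clear_lists word_cong_lists append.hyps by blast+
    have gl': "clear d g' \<in> lists A" "clear d h' \<in> lists A"
      using clear_lists word_cong_lists append.hyps by blast+
    \<comment> \<open>Centrality brings each power of \<open>D\<close> next to the numerator it
      belongs to, so that the two hypotheses can be concatenated; step 3 undoes this on the other
      side.\<close>
    have 1: "(?p h @ (?p h' @ clear d g) @ clear d g', ?p h @ (clear d g @ ?p h') @ clear d g') \<in> C"
      using pow_central gl gl' pow_lists apl apr by presburger
    have 2: "((?p h @ clear d g) @ (?p h' @ clear d g'), (?p g @ clear d h) @ (?p g' @ clear d h')) \<in> C"
      unfolding C_def using append.IH[unfolded C_def] by (rule word_cong.append)
    have 3: "(?p g @ (clear d h @ ?p g') @ clear d h', ?p g @ (?p g' @ clear d h) @ clear d h') \<in> C"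
      using sym pow_central gl gl' pow_lists apl apr by presburger
    show ?case
      using cong[OF cong[OF 1[unfolded append_assoc] 2[unfolded append_assoc]] 3[unfolded append_assoc]]
      by (simp add: word_pow_add)
  qed
  show ?thesis
  proof (rule inj_onI)
    fix X Y
    assume XY: "X \<in> carrier (presented_monoid A R)" "Y \<in> carrier (presented_monoid A R)"
      and eq: "localization A R X = localization A R Y"
    obtain u v where u: "u \<in> lists A" "X = C `` {u}" and v: "v \<in> lists A" "Y = C `` {v}"
      using XY by (auto simp: C_def elim!: presented_monoid_carrierE)
    have "map Pos u \<in> lists (group_letters A)" "map Pos v \<in> lists (group_letters A)"
      using u v by (auto simp: group_letters_def)
    then have "(map Pos u, map Pos v) \<in> word_cong (group_letters A) (group_rels A R)"
      using eq u v by (simp add: C_def localization_class word_cong_class_eq_iff)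
    from main[OF this] have "(u, v) \<in> C" by simp
    then show "X = Y" using u v by (simp add: C_def word_cong_class_eq_iff)
  qed
qed


subsection \<open>Monoids with one cyclic relation\<close>

abbreviation cyc_cong :: "'a list \<Rightarrow> ('a list \<times> 'a list) set" where
  "cyc_cong xs \<equiv> word_cong (set xs) (cyclic_rels xs)"

lemma cyclic_rels_length: "(u, v) \<in> cyclic_rels xs \<Longrightarrow> length u = length v"
  by (auto simp: cyclic_rels_def)

lemma word_cong_length:
  assumes "(u, v) \<in> word_cong A R" "\<And>u v. (u, v) \<in> R \<Longrightarrow> length u = length v"
  shows "length u = length v"
  using assms(1) by (induction rule: word_cong.induct) (auto dest: assms(2))

text \<open>With distinct letters, the first letter of a rotation fixes the offset modulo the
  length. Hence every letter has exactly one complement in the cyclic word.\<close>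

lemma rotate_eq_Cons_unique:
  assumes "distinct xs" "rotate i xs = c # p" "rotate j xs = c # q"
  shows "p = q"
proof -
  have "xs \<noteq> []" using assms(2) by auto
  then have "xs ! (i mod length xs) = xs ! (j mod length xs)"
    using assms(2,3) hd_rotate_conv_nth by (metis list.sel(1))
  then have "i mod length xs = j mod length xs"
    using assms(1) \<open>xs \<noteq> []\<close> by (simp add: nth_eq_iff_index_eq)
  then show ?thesis using assms(2,3) by (metis rotate_conv_mod list.inject)
qed

lemma cyc_cong_rotate: "(rotate i xs, rotate j xs) \<in> cyc_cong xs"
  by (intro word_cong.rel) (auto simp: cyclic_rels_def in_lists_conv_set)

text \<open>Since the relation is homogeneous, cancellation and the description of common multiples can be
  proved together by induction on the length: composing two relations \<open>a X = c V = b Y\<close> needs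
  cancellation only inside \<open>V\<close>.\<close>

lemma cyc_cong_ConsE:
  assumes xs: "distinct xs" and "(a # X, b # Y) \<in> cyc_cong xs"
  shows "a = b \<and> (X, Y) \<in> cyc_cong xs \<or>
    (\<exists>i j p q Z. rotate i xs = a # p \<and> rotate j xs = b # q \<and>
      (X, p @ Z) \<in> cyc_cong xs \<and> (Y, q @ Z) \<in> cyc_cong xs)"
proof -
  let ?C = "cyc_cong xs"
  define Q where "Q a X b Y \<longleftrightarrow> a = b \<and> (X, Y) \<in> ?C \<or>
    (\<exists>i j p q Z. rotate i xs = a # p \<and> rotate j xs = b # q \<and>
      (X, p @ Z) \<in> ?C \<and> (Y, q @ Z) \<in> ?C)" for a b X Y
  note sym = word_cong.sym[of _ _ "set xs" "cyclic_rels xs"]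
  note tr = word_cong.trans[of _ _ "set xs" "cyclic_rels xs"]
  have len: "length u = length v" if "(u, v) \<in> ?C" for u v
    using that cyclic_rels_length by (rule word_cong_length)
  have Q: "Q a X b Y" if "(a # X, b # Y) \<in> ?C" "length X = L" for L a X b Y
    using that
  proof (induction L arbitrary: a X b Y rule: less_induct)
    case (less L)
    \<comment> \<open>At smaller length the claim already yields cancellation of a letter: for equal
      first letters the two complements coincide, so both tails equal the same
      \<open>p @ Z\<close>.\<close>
    have cancel1: "(X, Y) \<in> ?C" if "(c # X, c # Y) \<in> ?C" "length X < L" for c X Y
    proof -
      have "Q c X c Y" using less.IH that by blast
      then show ?thesis
        unfolding Q_def using rotate_eq_Cons_unique[OF xs] sym tr by metis
    qed
    have cancel: "(Z, Z') \<in> ?C" if "(p @ Z, p @ Z') \<in> ?C" "length (p @ Z) \<le> L" for p Z Z'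
      using that
    proof (induction p)
      case (Cons c p)
      then show ?case using cancel1[of c "p @ Z" "p @ Z'"] by simp
    qed simp
    \<comment> \<open>The inner induction runs over derivations, so the splittings into first letter
      and tail are quantified inside the claim, with \<open>L\<close> kept fixed.\<close>
    have "\<forall>a X b Y. u = a # X \<longrightarrow> v = b # Y \<longrightarrow> length X = L \<longrightarrow> Q a X b Y"
      if "(u, v) \<in> ?C" for u v
      using that
    proof (induction rule: word_cong.induct)
      case (rel u v)
      show ?case
      proof (intro allI impI)
        fix a X b Y assume u: "u = a # X" and v: "v = b # Y"
        obtain i j where ij: "u = rotate i xs" "v = rotate j xs"
          using rel by (auto simp: cyclic_rels_def)
        have "(X, X @ []) \<in> ?C" "(Y, Y @ []) \<in> ?C"
          using rel u v by (auto intro: word_cong.refl)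
        \<comment> \<open>The relation is itself the common multiple, with empty remainder
          \<open>Z\<close>.\<close>
        then show "Q a X b Y" using u v ij unfolding Q_def by metis
      qed
    next
      case (refl u)
      then show ?case by (auto simp: Q_def intro: word_cong.refl)
    next
      case (sym u v)
      show ?case
      proof (intro allI impI)
        fix a X b Y assume "v = a # X" "u = b # Y" "length X = L"
        moreover from this have "length Y = L" using len[OF sym.hyps] by simp
        ultimately have "Q b Y a X" using sym.IH by blast
        then show "Q a X b Y" unfolding Q_def using word_cong.sym by metis
      qed
    next
      case (trans u w v)
      show ?case
      proof (intro allI impI)
        fix a X b Y assume u: "u = a # X" and v: "v = b # Y" and L: "length X = L"
        obtain c V where w: "w = c # V" "length V = L"
          using len[OF trans.hyps(1)] u L by (cases w) auto
        have 1: "Q a X c V" and 2: "Q c V b Y" using trans.IH u v w L by blast+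
        show "Q a X b Y"
        proof (cases "(a = c \<and> (X, V) \<in> ?C) \<or> (c = b \<and> (V, Y) \<in> ?C)")
          case True
          then show ?thesis using 1 2 sym tr unfolding Q_def by metis
        next
          case False
          obtain i j p r Z where ir: "rotate i xs = a # p" "rotate j xs = c # r"
            "(X, p @ Z) \<in> ?C" "(V, r @ Z) \<in> ?C" using 1 False unfolding Q_def by metis
          obtain i' j' r' q Z' where ir': "rotate i' xs = c # r'" "rotate j' xs = b # q"
            "(V, r' @ Z') \<in> ?C" "(Y, q @ Z') \<in> ?C" using 2 False unfolding Q_def by metis
          \<comment> \<open>Both links pass through the same complement of \<open>c\<close>, so
            \<open>V\<close> equals both \<open>r @ Z\<close> and \<open>r @ Z'\<close>. Cancelling
            \<open>r\<close> stays within length \<open>L\<close>, and the two multiples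
            merge.\<close>
          have [simp]: "r' = r" using rotate_eq_Cons_unique[OF xs] ir ir' by blast
          have "(r @ Z, r @ Z') \<in> ?C" using tr[OF sym[OF ir(4)] ir'(3)] by simp
          then have "(Z, Z') \<in> ?C" using cancel len[OF ir(4)] w(2) by simp
          moreover have "q \<in> lists (set xs)" using word_cong_lists[OF ir'(4)] by simp
          ultimately have "(q @ Z', q @ Z) \<in> ?C" using word_cong_append_left sym by blast
          then have "(Y, q @ Z) \<in> ?C" using ir'(4) tr by blast
          then show ?thesis using ir ir'(2) unfolding Q_def by metis
        qed
      qed
    next
      case (append u v u' v')
      show ?case
      proof (intro allI impI)
        fix a X b Y
        assume u: "u @ u' = a # X" and v: "v @ v' = b # Y" and L: "length X = L"
        show "Q a X b Y"
        proof (cases u)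
          case Nil
          then have "v = []" using len[OF append.hyps(1)] by simp
          then show ?thesis using Nil append.IH u v L by simp
        next
          case (Cons a' U)
          then obtain V where uv: "u = a # U" "v = b # V"
            using u v len[OF append.hyps(1)] by (cases v) auto
          have X: "X = U @ u'" and Y: "Y = V @ v'" using u v uv by auto
          have gl: "u' \<in> lists (set xs)" using word_cong_lists[OF append.hyps(2)] by simp
          have "length U \<le> L" using X L by simp
          \<comment> \<open>If \<open>U\<close> has length \<open>L\<close>, then \<open>u'\<close>
            is empty and the hypothesis on derivations applies; a shorter \<open>U\<close> falls
            under the induction on length.\<close>
          then have "Q a U b V"
            using append.IH(1) less.IH[of "length U" a U b V] append.hyps(1) uv
            by (cases "length U = L") auto
          then consider "a = b" "(U, V) \<in> ?C"
            | i j p q Z where "rotate i xs = a # p" "rotate j xs = b # q"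
              "(U, p @ Z) \<in> ?C" "(V, q @ Z) \<in> ?C"
            unfolding Q_def by metis
          then show ?thesis
          proof cases
            case 1
            then show ?thesis using append.hyps(2) word_cong.append unfolding Q_def X Y by blast
          next
            case 2
            have "(U @ u', (p @ Z) @ u') \<in> ?C" using 2 gl word_cong_append_right by blast
            moreover have "(V @ v', (q @ Z) @ u') \<in> ?C"
              using 2(4) sym[OF append.hyps(2)] word_cong.append by blast
            ultimately show ?thesis using 2(1,2) unfolding Q_def X Y by (metis append.assoc)
          qed
        qed
      qed
    qed
    then show ?case using less.prems by blast
  qed
  show ?thesis using Q[OF assms(2) HOL.refl] unfolding Q_def .
qed

text \<open>Equal first letters have equal complements, so both alternatives of
  \<open>cyc_cong_ConsE\<close> give congruent tails.\<close>

lemma cyc_cong_cancel: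
  assumes "distinct xs" "(p @ X, p @ Y) \<in> cyc_cong xs"
  shows "(X, Y) \<in> cyc_cong xs"
  using assms(2)
proof (induction p)
  case (Cons a p)
  have "(a # p @ X, a # p @ Y) \<in> cyc_cong xs" using Cons.prems by simp
  from cyc_cong_ConsE[OF assms(1) this] have "(p @ X, p @ Y) \<in> cyc_cong xs"
    using rotate_eq_Cons_unique[OF assms(1)] word_cong.sym word_cong.trans by metis
  then show ?case by (rule Cons.IH)
qed simp


subsection \<open>Two cyclic relations sharing a letter\<close>

text \<open>The relations of \<open>rels m n\<close> with arbitrary words in place of the two
  indexed families. This makes the families interchangeable, so each result is proved for one of
  them only.\<close>

definition two_cyc_rels :: "'a \<Rightarrow> 'a list \<Rightarrow> 'a list \<Rightarrow> ('a list \<times> 'a list) set" where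
  "two_cyc_rels s ts us = cyclic_rels (s # ts) \<union> cyclic_rels (s # us) \<union>
    (\<Union>a\<in>set ts. \<Union>b\<in>set us. cyclic_rels [a, b])"

definition two_cyc_cong :: "'a \<Rightarrow> 'a list \<Rightarrow> 'a list \<Rightarrow> ('a list \<times> 'a list) set" where
  "two_cyc_cong s ts us = word_cong ({s} \<union> set ts \<union> set us) (two_cyc_rels s ts us)"

lemmas two_cyc_cong_refl = word_cong.refl[of _ "{s} \<union> set ts \<union> set us" "two_cyc_rels s ts us", folded two_cyc_cong_def]
  for s ts us
lemmas two_cyc_cong_trans = word_cong.trans[of _ _ "{s} \<union> set ts \<union> set us" "two_cyc_rels s ts us", folded two_cyc_cong_def]
  for s ts us
lemmas two_cyc_cong_append = word_cong.append[of _ _ "{s} \<union> set ts \<union> set us" "two_cyc_rels s ts us", folded two_cyc_cong_def]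
  for s ts us

lemma cyclic_rels_pair: "cyclic_rels [a, b] = {[a, b], [b, a]} \<times> {[a, b], [b, a]}"
proof -
  have "range (\<lambda>i. rotate i [a, b]) = {[a, b], [b, a]}"
  proof
    show "range (\<lambda>i. rotate i [a, b]) \<subseteq> {[a, b], [b, a]}"
    proof
      fix x assume "x \<in> range (\<lambda>i. rotate i [a, b])"
      then obtain i where "x = rotate i [a, b]" by blast
      then show "x \<in> {[a, b], [b, a]}" by (induction i arbitrary: x) auto
    qed
    have "[a, b] = rotate 0 [a, b]" "[b, a] = rotate 1 [a, b]" by simp_all
    then show "{[a, b], [b, a]} \<subseteq> range (\<lambda>i. rotate i [a, b])" by blast
  qed
  moreover have "cyclic_rels [a, b] = range (\<lambda>i. rotate i [a, b]) \<times> range (\<lambda>i. rotate i [a, b])"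
    by (auto simp: cyclic_rels_def)
  ultimately show ?thesis by simp
qed

lemma two_cyc_cong_commute: "two_cyc_cong s ts us = two_cyc_cong s us ts"
proof -
  have "cyclic_rels [a, b] = cyclic_rels [b, a]" for a b :: 'a
    by (auto simp: cyclic_rels_pair)
  then have "(\<Union>a\<in>set ts. \<Union>b\<in>set us. cyclic_rels [a, b]) = (\<Union>a\<in>set us. \<Union>b\<in>set ts. cyclic_rels [a, b])"
    by blast
  then have "two_cyc_rels s ts us = two_cyc_rels s us ts"
    unfolding two_cyc_rels_def by (metis Un_commute)
  moreover have "{s} \<union> set ts \<union> set us = {s} \<union> set us \<union> set ts" by blast
  ultimately show ?thesis by (simp add: two_cyc_cong_def)
qed

lemma cyc_cong_imp_two_cyc_cong: "(x, y) \<in> cyc_cong (s # ts) \<Longrightarrow> (x, y) \<in> two_cyc_cong s ts us"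
  unfolding two_cyc_cong_def by (erule word_cong_mono) (auto simp: two_cyc_rels_def)

lemma two_cyc_cong_comm:
  assumes "v \<in> lists (set ts)" "w \<in> lists (set us)"
  shows "(v @ w, w @ v) \<in> two_cyc_cong s ts us"
proof -
  let ?A = "{s} \<union> set ts \<union> set us"
  have 1: "([b, a], [a, b]) \<in> two_cyc_cong s ts us" if "a \<in> set ts" "b \<in> set us" for a b
    unfolding two_cyc_cong_def using that
    by (intro word_cong.rel) (auto simp: two_cyc_rels_def cyclic_rels_pair)
  have "(b # v, v @ [b]) \<in> two_cyc_cong s ts us" if "b \<in> set us" for b
    using word_cong_comm_lists[of v "[b]" ?A "two_cyc_rels s ts us"] 1 assms(1) that
    by (auto simp: two_cyc_cong_def)
  then show ?thesis
    unfolding two_cyc_cong_def using assms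
    by (intro word_cong_comm_lists) (auto intro: word_cong.sym)
qed

section \<open>Erasing one family of letters\<close>

lemma filter_mem_rotate_shared:
  assumes "distinct (s # us)" "set ts \<inter> set us = {}"
  shows "filter (\<lambda>a. a \<in> set (s # ts)) (rotate i (s # us)) = [s]"
proof -
  let ?r = "filter (\<lambda>a. a \<in> set (s # ts)) (rotate i (s # us))"
  have "distinct (rotate i (s # us))" using assms(1) by (simp only: distinct_rotate)
  then have d: "distinct ?r" by (rule distinct_filter)
  have e: "set ?r = {s}" using assms by (simp only: set_filter set_rotate) auto
  have "xs = [s]" if "distinct xs" "set xs = {s}" for xs
    using that by (cases xs; cases "tl xs") auto
  from this[OF d e] show ?thesis .
qed

text \<open>Under the erasure of \<open>us\<close>, the relations on \<open>s # ts\<close> are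
  unchanged, those on \<open>s # us\<close> collapse to \<open>s = s\<close>, and a commutation of
  \<open>a\<close> with \<open>b\<close> collapses to \<open>a = a\<close>. The erasure is thus well
  defined on congruence classes.\<close>

lemma filter_mem_cyc_cong:
  assumes "(X, Y) \<in> two_cyc_cong s ts us"
    and dist: "distinct (s # us)" and disj: "set ts \<inter> set us = {}"
  shows "(filter (\<lambda>a. a \<in> set (s # ts)) X, filter (\<lambda>a. a \<in> set (s # ts)) Y) \<in> cyc_cong (s # ts)"
  using assms(1) unfolding two_cyc_cong_def
proof (induction rule: word_cong.induct)
  case (rel u v)
  let ?f = "filter (\<lambda>a. a \<in> set (s # ts))"
  from rel(1) consider (t) i j where "u = rotate i (s # ts)" "v = rotate j (s # ts)"
    | (u) i j where "u = rotate i (s # us)" "v = rotate j (s # us)"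
    | (c) a b where "a \<in> set ts" "b \<in> set us" "u \<in> {[a, b], [b, a]}" "v \<in> {[a, b], [b, a]}"
    unfolding two_cyc_rels_def by (auto simp: cyclic_rels_pair) (auto simp: cyclic_rels_def)
  then show ?case
  proof cases
    case t
    have "?f (rotate i (s # ts)) = rotate i (s # ts)" for i
      by (rule filter_True) (simp only: set_rotate, simp)
    then show ?thesis using t cyc_cong_rotate by metis
  next
    case u
    then have "?f u = [s]" "?f v = [s]"
      using filter_mem_rotate_shared[OF dist disj] by blast+
    then show ?thesis using u by (simp add: word_cong.refl)
  next
    case c
    then have "b \<notin> set (s # ts)" using disj dist by auto
    then have "?f u = [a]" "?f v = [a]" using c by auto
    then show ?thesis using c by (simp add: word_cong.refl)
  qed
next
  case (refl u)
  then show ?case by (intro word_cong.refl) auto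
next
  case (append u v u' v')
  then show ?case by (simp only: filter_append word_cong.append)
qed (blast intro: word_cong.sym word_cong.trans)+

text \<open>A leading letter of \<open>us\<close> can be moved past the already sorted block of
  \<open>ts\<close> by the commutation relations.\<close>

lemma two_cyc_cong_sort:
  assumes "X \<in> lists (set ts \<union> set us)" "set ts \<inter> set us = {}"
  shows "(X, filter (\<lambda>a. a \<in> set ts) X @ filter (\<lambda>a. a \<in> set us) X) \<in> two_cyc_cong s ts us"
  using assms(1)
proof (induction X)
  case Nil
  then show ?case by (simp add: two_cyc_cong_def word_cong.refl)
next
  case (Cons a X)
  let ?t = "filter (\<lambda>a. a \<in> set ts)" and ?u = "filter (\<lambda>a. a \<in> set us)"
  have 1: "(a # X, a # ?t X @ ?u X) \<in> two_cyc_cong s ts us"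
    using Cons unfolding two_cyc_cong_def by (auto intro: word_cong_Cons)
  show ?case
  proof (cases "a \<in> set ts")
    case True
    then have "a \<notin> set us" using assms(2) by auto
    then show ?thesis using 1 True by simp
  next
    case False
    then have a: "a \<in> set us" using Cons by auto
    have "([a] @ ?t X, ?t X @ [a]) \<in> two_cyc_cong s us ts"
      using a by (intro two_cyc_cong_comm) auto
    then have "([a] @ ?t X, ?t X @ [a]) \<in> two_cyc_cong s ts us"
      by (simp only: two_cyc_cong_commute[of s us ts])
    then have "(([a] @ ?t X) @ ?u X, (?t X @ [a]) @ ?u X) \<in> two_cyc_cong s ts us"
      unfolding two_cyc_cong_def by (rule word_cong_append_right) auto
    then show ?thesis using 1 False a word_cong.trans by (fastforce simp: two_cyc_cong_def)
  qed
qed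

lemma filter_insert_notin:
  "s \<notin> set X \<Longrightarrow> filter (\<lambda>a. a \<in> set (s # ts)) X = filter (\<lambda>a. a \<in> set ts) X"
  by (rule filter_cong) auto

text \<open>Both erasures keep \<open>s\<close>, so its occurrences cut \<open>X\<close> and
  \<open>Y\<close> into corresponding blocks. Inside a block the two families commute, and sorting
  shows that it is determined by its erasures.\<close>

lemma two_cyc_cong_if_filters_eq:
  assumes "X \<in> lists ({s} \<union> set ts \<union> set us)" "Y \<in> lists ({s} \<union> set ts \<union> set us)"
    and "filter (\<lambda>a. a \<in> set (s # ts)) X = filter (\<lambda>a. a \<in> set (s # ts)) Y"
    and "filter (\<lambda>a. a \<in> set (s # us)) X = filter (\<lambda>a. a \<in> set (s # us)) Y"
    and disj: "set ts \<inter> set us = {}"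
  shows "(X, Y) \<in> two_cyc_cong s ts us"
  using assms(1-4)
proof (induction "length X" arbitrary: X Y rule: less_induct)
  case less
  let ?t = "filter (\<lambda>a. a \<in> set (s # ts))" and ?u = "filter (\<lambda>a. a \<in> set (s # us))"
  have base: "(X, Y) \<in> two_cyc_cong s ts us"
    if "s \<notin> set X" "s \<notin> set Y" "X \<in> lists ({s} \<union> set ts \<union> set us)"
      "Y \<in> lists ({s} \<union> set ts \<union> set us)" "?t X = ?t Y" "?u X = ?u Y" for X Y
  proof -
    have "X \<in> lists (set ts \<union> set us)" "Y \<in> lists (set ts \<union> set us)"
      using that(1-4) by (auto simp: in_lists_conv_set)
    then show ?thesis
      using two_cyc_cong_sort[OF _ disj, of X s] two_cyc_cong_sort[OF _ disj, of Y s] that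
      unfolding two_cyc_cong_def
      by (metis filter_insert_notin word_cong.sym word_cong.trans)
  qed
  have s_iff: "s \<in> set X \<longleftrightarrow> s \<in> set Y"
  proof -
    have "s \<in> set (?t X) \<longleftrightarrow> s \<in> set (?t Y)" using less.prems(3) by simp
    then show ?thesis by simp
  qed
  show ?case
  proof (cases "s \<in> set X")
    case False
    then show ?thesis using base s_iff less.prems by blast
  next
    case True
    then obtain X1 X2 where X: "X = X1 @ s # X2" "s \<notin> set X1" by (meson split_list_first)
    obtain Y1 Y2 where Y: "Y = Y1 @ s # Y2" "s \<notin> set Y1" using True s_iff by (meson split_list_first)
    have split: "p = p' \<and> q = q'" if "p @ s # q = p' @ s # q'" "s \<notin> set p" "s \<notin> set p'" for p q p' q'
      using that by (induction p arbitrary: p') (auto simp: Cons_eq_append_conv)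
    \<comment> \<open>Cutting at the first \<open>s\<close> commutes with both erasures; the
      prefixes are \<open>s\<close>-free blocks, the suffixes are left to the induction.\<close>
    have t: "?t X1 = ?t Y1 \<and> ?t X2 = ?t Y2"
      by (rule split) (use less.prems(3) X Y in simp_all)
    have u: "?u X1 = ?u Y1 \<and> ?u X2 = ?u Y2"
      by (rule split) (use less.prems(4) X Y in simp_all)
    have 1: "(X1, Y1) \<in> two_cyc_cong s ts us"
      by (rule base) (use X Y t u less.prems(1,2) in auto)
    have 2: "(X2, Y2) \<in> two_cyc_cong s ts us"
      by (rule less.hyps) (use X Y t u less.prems(1,2) in auto)
    show ?thesis unfolding X Y using 1 2 unfolding two_cyc_cong_def
      by (intro word_cong.append word_cong_Cons) auto
  qed
qed

section \<open>Lifting derivations along an erasure\<close>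

text \<open>The erased word is a rotation, so \<open>X\<close> contains \<open>s\<close> exactly
  once. Letters of \<open>us\<close> before this \<open>s\<close> move to the far left and those
  after it to the far right; the rotation becomes a factor of the word and can be replaced, while
  the order of \<open>s\<close> and \<open>us\<close> is preserved.\<close>

lemma lift_rotation:
  assumes X: "X \<in> lists ({s} \<union> set ts \<union> set us)"
    and f: "filter (\<lambda>a. a \<in> set (s # ts)) X = rotate i (s # ts)"
    and dist: "distinct (s # ts)" "distinct (s # us)" and disj: "set ts \<inter> set us = {}"
  shows "\<exists>Y. (X, Y) \<in> two_cyc_cong s ts us \<and> filter (\<lambda>a. a \<in> set (s # ts)) Y = rotate j (s # ts) \<and>
    filter (\<lambda>a. a \<in> set (s # us)) Y = filter (\<lambda>a. a \<in> set (s # us)) X"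
proof -
  let ?C = "two_cyc_cong s ts us"
  let ?st = "filter (\<lambda>a. a \<in> set (s # ts))" and ?su = "filter (\<lambda>a. a \<in> set (s # us))"
  let ?t = "filter (\<lambda>a. a \<in> set ts)" and ?u = "filter (\<lambda>a. a \<in> set us)"
  have dist_rot: "distinct (?st X)"
    unfolding f distinct_rotate by (rule dist(1))
  have "s \<in> set (?st X)"
    unfolding f set_rotate by (rule list.set_intros(1))
  then have "s \<in> set X" by simp
  then obtain X1 X2 where X12: "X = X1 @ s # X2" by (meson split_list)
  have "distinct (?st X1 @ s # ?st X2)"
    using dist_rot unfolding X12 by (simp only: filter_append filter.simps list.set_intros if_True)
  then have "s \<notin> set (?st X1)" "s \<notin> set (?st X2)"
    unfolding distinct_append distinct.simps by auto
  then have s: "s \<notin> set X1" "s \<notin> set X2" by simp_all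
  have l: "X1 \<in> lists (set ts \<union> set us)" "X2 \<in> lists (set ts \<union> set us)"
    using X X12 s by (auto simp: in_lists_conv_set)
  note tr = two_cyc_cong_trans and ap = two_cyc_cong_append and rf = two_cyc_cong_refl
  have X1: "(X1, ?u X1 @ ?t X1) \<in> ?C"
    using two_cyc_cong_sort[of X1 us ts s] l disj
    by (simp add: two_cyc_cong_commute[of s us ts] Un_commute Int_commute)
  have X2: "(X2, ?t X2 @ ?u X2) \<in> ?C"
    using two_cyc_cong_sort[of X2 ts us s] l disj by simp
  have rot: "?t X1 @ s # ?t X2 = rotate i (s # ts)"
    using f unfolding X12 by (simp only: filter_append filter.simps filter_insert_notin[OF s(1)]
      filter_insert_notin[OF s(2)] list.set_intros if_True)
  let ?Y = "?u X1 @ rotate j (s # ts) @ ?u X2"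
  have "(X1 @ [s] @ X2, (?u X1 @ ?t X1) @ [s] @ (?t X2 @ ?u X2)) \<in> ?C"
    using X1 X2 by (intro ap rf) auto
  then have 1: "(X, ?u X1 @ rotate i (s # ts) @ ?u X2) \<in> ?C"
    using X12 by (simp flip: rot)
  have 2: "(?u X1 @ rotate i (s # ts) @ ?u X2, ?Y) \<in> ?C"
    by (intro ap rf cyc_cong_imp_two_cyc_cong cyc_cong_rotate) auto
  have "?st (?u w) = []" for w
    using disj dist by (auto simp: filter_empty_conv)
  moreover have "?st (rotate j (s # ts)) = rotate j (s # ts)"
    by (rule filter_True) (simp only: set_rotate, simp)
  ultimately have 3: "?st ?Y = rotate j (s # ts)" by simp
  have rot_s: "?su (rotate j (s # ts)) = [s]"
    using dist(1) disj by (intro filter_mem_rotate_shared) blast+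
  have "?su (?u w) = ?u w" for w
    by (rule filter_True) auto
  then have "?su ?Y = ?u X1 @ s # ?u X2" using rot_s by simp
  moreover have "?su X = ?u X1 @ s # ?u X2"
    unfolding X12 by (simp only: filter_append filter.simps filter_insert_notin[OF s(1)]
      filter_insert_notin[OF s(2)] list.set_intros if_True)
  ultimately have "?su ?Y = ?su X" by simp
  then show ?thesis using tr[OF 1 2] 3 by blast
qed

lemma filter_eq_append_split:
  "filter P X = u @ v \<Longrightarrow> \<exists>X1 X2. X = X1 @ X2 \<and> filter P X1 = u \<and> filter P X2 = v"
proof (induction u arbitrary: X)
  case Nil
  then show ?case by (intro exI[of _ "[]"] exI[of _ X]) simp
next
  case (Cons a u)
  then obtain Y Z where YZ: "X = Y @ a # Z" "\<forall>y\<in>set Y. \<not> P y" "P a" "filter P Z = u @ v"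
    by (auto simp: filter_eq_Cons_iff)
  from Cons.IH[OF YZ(4)] obtain Z1 Z2 where "Z = Z1 @ Z2" "filter P Z1 = u" "filter P Z2 = v"
    by blast
  then show ?case using YZ by (intro exI[of _ "Y @ a # Z1"] exI[of _ Z2]) simp
qed

text \<open>Every derivation for \<open>s # ts\<close> can be followed on a preimage without
  disturbing the other erasure, one application of a relation at a time by
  \<open>lift_rotation\<close>.\<close>

lemma lift_cyc_cong:
  assumes "(p, q) \<in> cyc_cong (s # ts)"
    and dist: "distinct (s # ts)" "distinct (s # us)" and disj: "set ts \<inter> set us = {}"
  shows "\<forall>X\<in>lists ({s} \<union> set ts \<union> set us). filter (\<lambda>a. a \<in> set (s # ts)) X = p \<longrightarrow>
      (\<exists>Y. (X, Y) \<in> two_cyc_cong s ts us \<and> filter (\<lambda>a. a \<in> set (s # ts)) Y = q \<and>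
        filter (\<lambda>a. a \<in> set (s # us)) Y = filter (\<lambda>a. a \<in> set (s # us)) X)"
proof -
  let ?C = "two_cyc_cong s ts us"
  let ?st = "filter (\<lambda>a. a \<in> set (s # ts))" and ?su = "filter (\<lambda>a. a \<in> set (s # us))"
  define L where "L = lists ({s} \<union> set ts \<union> set us)"
  define Q where "Q p q \<longleftrightarrow> (\<forall>X\<in>L. ?st X = p \<longrightarrow> (\<exists>Y. (X, Y) \<in> ?C \<and> ?st Y = q \<and> ?su Y = ?su X))" for p q
  have Q_D: "\<exists>Y. (X, Y) \<in> ?C \<and> ?st Y = q \<and> ?su Y = ?su X" if "Q p q" "X \<in> L" "?st X = p" for p q X
    using that unfolding Q_def by blast
  have CL: "x \<in> L \<and> y \<in> L" if "(x, y) \<in> ?C" for x y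
    using word_cong_lists that unfolding two_cyc_cong_def L_def by blast
  \<comment> \<open>Both directions are carried along because \<open>Q\<close> is not visibly
    symmetric; the symmetry rule then only swaps the conjuncts.\<close>
  have "Q p q \<and> Q q p"
    using assms(1)
  proof (induction rule: word_cong.induct)
    case (rel u v)
    then obtain i j where uv: "u = rotate i (s # ts)" "v = rotate j (s # ts)"
      by (auto simp: cyclic_rels_def)
    show ?case
      unfolding Q_def L_def uv by (intro conjI ballI impI; rule lift_rotation[OF _ _ dist disj])
  next
    case (refl u)
    have "Q u u"
      unfolding Q_def L_def using two_cyc_cong_refl by metis
    then show ?case by blast
  next
    case (trans u v w)
    have "Q u w" if uv: "Q u v" and vw: "Q v w" for u v w
      unfolding Q_def
    proof (intro ballI impI)
      fix X assume X: "X \<in> L" "?st X = u"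
      then obtain Y where Y: "(X, Y) \<in> ?C" "?st Y = v" "?su Y = ?su X"
        using Q_D[OF uv X] by blast
      then obtain Z where Z: "(Y, Z) \<in> ?C" "?st Z = w" "?su Z = ?su Y"
        using Q_D[OF vw _ Y(2)] CL by blast
      have "(X, Z) \<in> ?C"
        using Y(1) Z(1) by (rule two_cyc_cong_trans)
      then show "\<exists>Z. (X, Z) \<in> ?C \<and> ?st Z = w \<and> ?su Z = ?su X"
        using Y Z by metis
    qed
    then show ?case using trans.IH by blast
  next
    case (append u v u' v')
    have "Q (u @ u') (v @ v')" if uv: "Q u v" and uv': "Q u' v'" for u v u' v'
      unfolding Q_def
    proof (intro ballI impI)
      fix X assume X: "X \<in> L" "?st X = u @ u'"
      then obtain X1 X2 where X12: "X = X1 @ X2" "?st X1 = u" "?st X2 = u'"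
        using filter_eq_append_split by blast
      then have "X1 \<in> L" "X2 \<in> L" using X by (auto simp: L_def)
      then obtain Y1 Y2 where Y: "(X1, Y1) \<in> ?C" "?st Y1 = v" "?su Y1 = ?su X1"
        "(X2, Y2) \<in> ?C" "?st Y2 = v'" "?su Y2 = ?su X2"
        using Q_D[OF uv _ X12(2)] Q_D[OF uv' _ X12(3)] by blast
      then have "(X, Y1 @ Y2) \<in> ?C"
        unfolding X12(1) by (intro two_cyc_cong_append)
      moreover have "?st (Y1 @ Y2) = v @ v'" "?su (Y1 @ Y2) = ?su X"
        using Y X12 by (simp_all only: filter_append)
      ultimately show "\<exists>Y. (X, Y) \<in> ?C \<and> ?st Y = v @ v' \<and> ?su Y = ?su X" by blast
    qed
    then show ?case using append.IH by blast
  qed blast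
  then show ?thesis unfolding Q_def L_def by blast
qed

text \<open>This is the fibre product description. Forwards, erasures respect the congruence.
  Backwards, the two derivations are lifted in turn, and words with the same erasures are
  congruent.\<close>

lemma two_cyc_cong_iff_filters:
  assumes XY: "X \<in> lists ({s} \<union> set ts \<union> set us)" "Y \<in> lists ({s} \<union> set ts \<union> set us)"
    and dist: "distinct (s # ts)" "distinct (s # us)" and disj: "set ts \<inter> set us = {}"
  shows "(X, Y) \<in> two_cyc_cong s ts us \<longleftrightarrow>
    (filter (\<lambda>a. a \<in> set (s # ts)) X, filter (\<lambda>a. a \<in> set (s # ts)) Y) \<in> cyc_cong (s # ts) \<and>
    (filter (\<lambda>a. a \<in> set (s # us)) X, filter (\<lambda>a. a \<in> set (s # us)) Y) \<in> cyc_cong (s # us)"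
    (is "_ \<longleftrightarrow> ?T \<and> ?U")
proof
  have disj': "set us \<inter> set ts = {}" using disj by blast
  let ?C = "two_cyc_cong s ts us"
  let ?A = "{s} \<union> set ts \<union> set us"
  let ?st = "filter (\<lambda>a. a \<in> set (s # ts))" and ?su = "filter (\<lambda>a. a \<in> set (s # us))"
  {
    assume "(X, Y) \<in> ?C"
    then show "?T \<and> ?U"
      using filter_mem_cyc_cong[OF _ dist(2) disj] filter_mem_cyc_cong[OF _ dist(1) disj']
        two_cyc_cong_commute[of s ts us] by blast
  next
    assume TU: "?T \<and> ?U"
    \<comment> \<open>\<open>X'\<close> has the \<open>ts\<close>-erasure of \<open>Y\<close> and
      still the \<open>us\<close>-erasure of \<open>X\<close>; the second lift \<open>X''\<close>
      corrects the latter and keeps the former.\<close>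
    obtain X' where X': "(X, X') \<in> ?C" "?st X' = ?st Y" "?su X' = ?su X"
      using lift_cyc_cong[OF conjunct1[OF TU] dist disj] XY by blast
    have X'A: "X' \<in> lists ?A"
      using X'(1) word_cong_lists unfolding two_cyc_cong_def by blast
    have A: "?A = {s} \<union> set us \<union> set ts" by blast
    obtain X'' where X'': "(X', X'') \<in> ?C" "?su X'' = ?su Y" "?st X'' = ?st X'"
      using lift_cyc_cong[OF conjunct2[OF TU] dist(2,1) disj'] X'A X'(3) A
        two_cyc_cong_commute[of s ts us] by auto
    have "X'' \<in> lists ?A"
      using X''(1) word_cong_lists unfolding two_cyc_cong_def by blast
    then have "(X'', Y) \<in> ?C"
      using two_cyc_cong_if_filters_eq[OF _ XY(2) _ _ disj] X' X'' by simp
    then show "(X, Y) \<in> ?C"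
      using X'(1) X''(1) by (blast intro: two_cyc_cong_trans)
  }
qed

section \<open>The central element and its cancellability\<close>

text \<open>Cutting the cyclic word at \<open>a\<close> as \<open>p @ a # q\<close>, the quotient is
  \<open>q @ p @ us\<close>: rotations put \<open>a\<close> at either end of \<open>q @ p\<close>,
  and \<open>us\<close> commutes with \<open>a\<close>.\<close>

lemma two_cyc_divides:
  assumes a: "a \<in> set (s # ts)"
  shows "\<exists>d. (a # d, s # ts @ us) \<in> two_cyc_cong s ts us \<and>
    (d @ [a], s # ts @ us) \<in> two_cyc_cong s ts us"
proof -
  let ?C = "two_cyc_cong s ts us"
  let ?A = "{s} \<union> set ts \<union> set us"
  note tr = two_cyc_cong_trans and ap = two_cyc_cong_append and rf = two_cyc_cong_refl
  have us: "(us, us) \<in> ?C" by (intro rf) auto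
  obtain p q where pq: "s # ts = p @ a # q" using a by (meson split_list)
  let ?d = "q @ p"
  have r1: "rotate (length p) (s # ts) = a # ?d"
    unfolding pq by (simp add: rotate_append)
  have r2: "rotate (Suc (length p)) (s # ts) = ?d @ [a]"
    unfolding rotate_Suc r1 by simp
  have r: "(a # ?d, s # ts) \<in> ?C" "(?d @ [a], s # ts) \<in> ?C"
    using cyc_cong_imp_two_cyc_cong cyc_cong_rotate[of _ "s # ts" 0] r1 r2
    by (metis id_apply rotate0)+
  have dA: "?d \<in> lists ?A"
    using r(1) word_cong_lists unfolding two_cyc_cong_def by fastforce
  have comm: "(us @ [a], [a] @ us) \<in> ?C"
  proof (cases "a = s")
    case True
    \<comment> \<open>For \<open>a = s\<close>, commuting with \<open>us\<close> is the cyclic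
      relation rotated by one place.\<close>
    have "(rotate 1 (s # us), rotate 0 (s # us)) \<in> two_cyc_cong s us ts"
      by (intro cyc_cong_imp_two_cyc_cong cyc_cong_rotate)
    then show ?thesis using True by (simp add: two_cyc_cong_commute[of s us ts])
  next
    case False
    then have "(us @ [a], [a] @ us) \<in> two_cyc_cong s us ts"
      using a by (intro two_cyc_cong_comm) auto
    then show ?thesis by (simp only: two_cyc_cong_commute[of s us ts])
  qed
  have "(a # ?d @ us, s # ts @ us) \<in> ?C" using ap[OF r(1) us] by simp
  moreover have "((?d @ us) @ [a], s # ts @ us) \<in> ?C"
    using tr[OF ap[OF rf[OF dA] comm]] ap[OF r(2) us] by simp
  ultimately show ?thesis by blast
qed

lemma localization_two_cyc_inj_on:
  fixes s :: 'a
  assumes dist: "distinct (s # ts)" "distinct (s # us)" and disj: "set ts \<inter> set us = {}"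
  defines "A \<equiv> {s} \<union> set ts \<union> set us" and "R \<equiv> two_cyc_rels s ts us"
  shows "inj_on (localization A R) (carrier (presented_monoid A R))"
proof -
  let ?D = "s # ts @ us"
  have C: "word_cong A R = two_cyc_cong s ts us"
    by (simp add: A_def R_def two_cyc_cong_def)
  \<comment> \<open>Exchanging the families in \<open>two_cyc_divides\<close> gives the multiple
    \<open>s # us @ ts\<close>, which must be identified with \<open>?D\<close>.\<close>
  have swap: "(s # us @ ts, ?D) \<in> word_cong A R"
  proof (rule word_cong_Cons)
    show "(us @ ts, ts @ us) \<in> word_cong A R"
      unfolding C two_cyc_cong_commute[of s ts us] by (rule two_cyc_cong_comm) auto
  qed (simp add: A_def)
  have "\<exists>d. (a # d, ?D) \<in> word_cong A R \<and> (d @ [a], ?D) \<in> word_cong A R" if "a \<in> A" for a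
  proof (cases "a \<in> set (s # ts)")
    case True
    then show ?thesis using two_cyc_divides C by metis
  next
    case False
    then have "a \<in> set (s # us)" using that by (auto simp: A_def)
    then show ?thesis
      using two_cyc_divides[of a s us ts] two_cyc_cong_commute[of s us ts] C swap word_cong.trans
      by metis
  qed
  then obtain d where d: "\<And>a. a \<in> A \<Longrightarrow> (a # d a, ?D) \<in> word_cong A R"
    "\<And>a. a \<in> A \<Longrightarrow> (d a @ [a], ?D) \<in> word_cong A R" by metis
  show ?thesis
  proof (rule localization_inj_on[OF d])
    show "?D \<in> lists A" by (auto simp: A_def)
    fix x y assume xy: "(?D @ x, ?D @ y) \<in> word_cong A R"
    then have l: "x \<in> lists A" "y \<in> lists A" "?D @ x \<in> lists A" "?D @ y \<in> lists A"
      using word_cong_lists[OF xy] by auto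
    note iff = two_cyc_cong_iff_filters[OF _ _ dist disj, folded A_def C]
    let ?st = "filter (\<lambda>a. a \<in> set (s # ts))" and ?su = "filter (\<lambda>a. a \<in> set (s # us))"
    have "?st us = []" "?su ts = []"
      using disj dist by (auto simp: filter_empty_conv)
    moreover have "?st ts = ts" "?su us = us" by (rule filter_True; simp)+
    \<comment> \<open>The erasures of \<open>?D\<close> are exactly the two cyclic words, so
      cancelling \<open>?D\<close> reduces to left cancellation in each one-relation factor.\<close>
    ultimately have D: "?st (?D @ w) = (s # ts) @ ?st w" "?su (?D @ w) = (s # us) @ ?su w" for w
      by simp_all
    have "((s # ts) @ ?st x, (s # ts) @ ?st y) \<in> cyc_cong (s # ts)"
      "((s # us) @ ?su x, (s # us) @ ?su y) \<in> cyc_cong (s # us)"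
      using xy unfolding iff[OF l(3,4)] D by blast+
    then show "(x, y) \<in> word_cong A R"
      unfolding iff[OF l(1,2)] using cyc_cong_cancel dist by blast
  qed auto
qed

theorem proposition5p1:
  fixes m n :: nat
  assumes "m \<ge> 2" and "n \<ge> 2"
  shows "inj_on (localization_hom m n) (carrier (G_monoid m n))"
proof -
  let ?ts = "map gen_t [1..<Suc m]" and ?us = "map gen_u [1..<Suc n]"
  have sets: "set ?ts = gen_t ` {1..m}" "set ?us = gen_u ` {1..n}"
    by (simp_all only: set_map set_upt atLeastLessThanSuc_atLeastAtMost)
  have "gens m n = {gen_s} \<union> set ?ts \<union> set ?us"
    by (simp only: gens_def sets)
  moreover have "rels m n = two_cyc_rels gen_s ?ts ?us"
    unfolding rels_def two_cyc_rels_def sets by simp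
  moreover have "distinct (gen_s # ?ts)" "distinct (gen_s # ?us)" "set ?ts \<inter> set ?us = {}"
    by (auto simp: distinct_map inj_on_def)
  ultimately show ?thesis
    unfolding localization_hom_def G_monoid_def using localization_two_cyc_inj_on by metis
qed

end
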